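(* Let $[b_1,\dots,b_s]$ be a Hirzebruch--Jung continued fraction (all $b_i\in\mathbb Z_{\ge 2}$) with $s\ge2$. Then the following hold: (i) If $[b_1,\dots,b_s]$ is a dual $1$-Wahl chain, then $\alpha([b_1,\dots,b_s])=1$. (ii) If $[b_1,\dots,b_s]$ is a dual $0$-Wahl chain, then $\alpha([b_1,\dots,b_s])=2$. Here $\alpha([b_1,\dots,b_s])$ denotes the minimal weight of an admissible zero continued fraction of $[b_1,\dots,b_s]$.
   Context: **Continued fractions.** $[b_1,\dots,b_s]$ denotes $b_1-\cfrac{1}{b_2-\cfrac{1}{\ddots-\cfrac{1}{b_s}}}$. **Dual $k$-Wahl chains** ($k\ge0$ an integer). Defined inductively: (1) the chain $[2,\dots,2]$ with $k+1$ consecutive $2$'s is a dual $k$-Wahl chain; (2) if $[b_1,\dots,b_\ell]$ is a dual $k$-Wahl chain, so are $[b_1+1,b_2,\dots,b_\ell,2]$ and $[2,b_1,\dots,b_{\ell-1},b_\ell+1]$ (for $\ell=1$ these are $[b_1+1,2]$ and $[2,b_1+1]$). **Zero continued fractions.** A zero continued fraction is a negative continued fraction $[a_1,\dots,a_s]=a_1-\cfrac{1}{a_2-\cfrac{1}{\ddots-\cfrac{1}{a_s}}}$ with integers $a_i\ge1$ whose value is $0$. These are taken to be exactly the sequences obtained from $[1,1]$ by finitely many blow-ups, a blow-up being one of $[\dots,u,v,\dots]\mapsto[\dots,u+1,1,v+1,\dots]$, $[u,\dots]\mapsto[1,u+1,\dots]$, $[\dots,v]\mapsto[\dots,v+1,1]$.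 Equivalently, they are the sequences $[v_1,\dots,v_s]$ for which there is a triangulation of a convex $(s+1)$-gon with vertices $P_0,\dots,P_s$ such that $v_i$ is the number of triangles containing $P_i$ for $1\le i\le s$. **Weight and $\alpha$.** Given $[b_1,\dots,b_s]$ with all $b_i\ge2$, it admits a zero continued fraction of weight $\lambda$ if there are indices $i_1<\dots<i_u$ with $u\ge1$ and integers $d_{i_j}\ge1$ such that subtracting $d_{i_j}$ from $b_{i_j}$ for each $j$ (leaving the other entries unchanged) yields a zero continued fraction, and $\lambda+1=\sum_{j=1}^u d_{i_j}$. The zero continued fractions $[e_1,\dots,e_s]$ arising in this way (so $1\le e_i\le b_i$) are called admissible for $[b_1,\dots,b_s]$. The minimum of the weights $\lambda$ over all such choices of indices $i_j$ and integers $d_{i_j}$ is denoted $\alpha([b_1,\dots,b_s])$. *)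

theory Defs
  imports Complex_Main "HOL-Library.Extended_Nat"
begin

section \<open>Negative (Hirzebruch--Jung) continued fractions\<close>

fun hj_value :: "int list \<Rightarrow> rat" where
  "hj_value [] = 0"
| "hj_value [b] = of_int b"
| "hj_value (b # c # bs) = of_int b - 1 / hj_value (c # bs)"

section \<open>Zero continued fractions\<close>

text \<open>
  Chains of positive entries with value zero are understood to be the chains generated from
  \<open>[1, 1]\<close> by blow-ups.  Soundness with respect to \<open>hj_value\<close>, with no division by
  zero involved, is \<open>zero_cf_value\<close> and \<open>zero_cf_tails_pos\<close> below.  The converse
  is deliberately not asserted: for example \<open>hj_value [1, 1, 1, 1] = 0\<close> holds only
  because \<open>1 / 0 = 0\<close>.
\<close>

inductive zero_cf :: "int list \<Rightarrow> bool" where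
  base: "zero_cf [1, 1]"
| blowup_inner: "zero_cf (xs @ [u, v] @ ys) \<Longrightarrow> zero_cf (xs @ [u + 1, 1, v + 1] @ ys)"
| blowup_left: "zero_cf (u # ys) \<Longrightarrow> zero_cf (1 # (u + 1) # ys)"
| blowup_right: "zero_cf (xs @ [v]) \<Longrightarrow> zero_cf (xs @ [v + 1, 1])"

section \<open>Dual Wahl chains\<close>

inductive dual_wahl :: "nat \<Rightarrow> int list \<Rightarrow> bool" for k :: nat where
  base: "dual_wahl k (replicate (k + 1) 2)"
| step_right: "dual_wahl k (b # bs) \<Longrightarrow> dual_wahl k ((b + 1) # bs @ [2])"
| step_left: "dual_wahl k (bs @ [b]) \<Longrightarrow> dual_wahl k (2 # bs @ [b + 1])"

section \<open>Weights of admissible zero continued fractions\<close>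

text \<open>Entries are indexed from zero, so \<open>b\<^sub>i\<close> is \<open>bs ! (i - 1)\<close>.\<close>

definition subtract_at :: "nat set \<Rightarrow> (nat \<Rightarrow> int) \<Rightarrow> int list \<Rightarrow> int list" where
  "subtract_at I d bs = map (\<lambda>i. if i \<in> I then bs ! i - d i else bs ! i) [0..<length bs]"

definition admits_zero_cf_of_weight :: "int list \<Rightarrow> nat \<Rightarrow> bool" where
  "admits_zero_cf_of_weight bs w \<longleftrightarrow>
     (\<exists>I d. I \<noteq> {} \<and> I \<subseteq> {..<length bs} \<and> (\<forall>i\<in>I. 1 \<le> d i) \<and>
            zero_cf (subtract_at I d bs) \<and> int w + 1 = (\<Sum>i\<in>I. d i))"

text \<open>
  Weights are natural numbers because the total amount subtracted is at least one.
  \<open>Inf\<close> of a nonempty set of extended naturals is its minimum, while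
  \<open>Inf {} = \<infinity>\<close>; hence a finite value of \<open>alpha\<close> is always
  attained, see \<open>alpha_eq_iff\<close>.
\<close>

definition alpha :: "int list \<Rightarrow> enat" where
  "alpha bs = Inf {enat w | w. admits_zero_cf_of_weight bs w}"

lemma alpha_eq_iff:
  "alpha bs = enat n \<longleftrightarrow>
     admits_zero_cf_of_weight bs n \<and> (\<forall>w. admits_zero_cf_of_weight bs w \<longrightarrow> n \<le> w)"
  (is "?L \<longleftrightarrow> ?R")
proof
  let ?S = "{enat w | w. admits_zero_cf_of_weight bs w}"
  assume L: ?L
  then have ne: "?S \<noteq> {}" by (auto simp: alpha_def Inf_enat_def split: if_splits)
  then have "Inf ?S \<in> ?S" using LeastI_ex[of "\<lambda>x. x \<in> ?S"] by (auto simp: Inf_enat_def)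
  moreover have "enat n \<le> enat w" if "admits_zero_cf_of_weight bs w" for w
    using L that Inf_lower[of "enat w" ?S] by (auto simp: alpha_def)
  ultimately show ?R using L by (auto simp: alpha_def)
next
  assume ?R
  then show ?L unfolding alpha_def by (intro antisym Inf_lower Inf_greatest) auto
qed

section \<open>Soundness of blow-ups\<close>

fun tails_pos :: "int list \<Rightarrow> bool" where
  "tails_pos [] = True"
| "tails_pos [b] = True"
| "tails_pos (b # c # bs) \<longleftrightarrow> 0 < hj_value (c # bs) \<and> tails_pos (c # bs)"

lemma blowup_inner_value:
  assumes "tails_pos (u # v # ys)"
  shows "hj_value ((u + 1) # 1 # (v + 1) # ys) = hj_value (u # v # ys)"
    and "tails_pos ((u + 1) # 1 # (v + 1) # ys)"
proof -
  define w where "w = hj_value (v # ys)"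
  have w: "w > 0" using assms by (simp add: w_def)
  have e: "hj_value ((v + 1) # ys) = w + 1"
    by (cases ys) (auto simp: w_def)
  have m: "1 - 1 / (w + 1) = w / (w + 1)" using w by (simp add: field_simps)
  show "hj_value ((u + 1) # 1 # (v + 1) # ys) = hj_value (u # v # ys)"
    using w by (simp add: e m w_def[symmetric]) (simp add: field_simps)
  have "tails_pos ((v + 1) # ys)" using assms by (cases ys) auto
  then show "tails_pos ((u + 1) # 1 # (v + 1) # ys)"
    using w by (simp add: e m)
qed

lemma value_cong_append:
  assumes "hj_value (a # as) = hj_value (b # bs)" "tails_pos (b # bs)"
    "tails_pos (xs @ a # as)"
  shows "hj_value (xs @ a # as) = hj_value (xs @ b # bs) \<and> tails_pos (xs @ b # bs)"
  using assms
proof (induction xs)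
  case Nil
  then show ?case by simp
next
  case (Cons x xs)
  then show ?case by (cases xs) auto
qed

lemma tails_pos_append: "tails_pos (xs @ a # as) \<Longrightarrow> tails_pos (a # as)"
proof (induction xs)
  case (Cons x xs)
  then show ?case by (cases xs) auto
qed simp

lemma zero_cf_sound:
  "zero_cf as \<Longrightarrow> hj_value as = 0 \<and> tails_pos as \<and> (\<forall>a\<in>set as. 1 \<le> a)"
proof (induction rule: zero_cf.induct)
  case base
  then show ?case by simp
next
  case (blowup_inner xs u v ys)
  then have t: "tails_pos (u # v # ys)" using tails_pos_append[of xs u "v # ys"] by simp
  show ?case
    using blowup_inner value_cong_append[OF blowup_inner_value(1)[OF t, symmetric]
      blowup_inner_value(2)[OF t], of xs] by auto
next
  case (blowup_left u ys)
  then show ?case by (cases ys) auto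
next
  case (blowup_right xs v)
  show ?case
    using blowup_right value_cong_append[of v "[]" "v + 1" "[1]" xs] by auto
qed

lemma zero_cf_value: "zero_cf as \<Longrightarrow> hj_value as = 0"
  and zero_cf_tails_pos: "zero_cf as \<Longrightarrow> tails_pos as"
  and zero_cf_entries: "zero_cf as \<Longrightarrow> a \<in> set as \<Longrightarrow> 1 \<le> a"
  using zero_cf_sound by blast+

end

theory Submission
  imports Defs
begin

text \<open>
  In the triangulation picture, let \<open>v\<^sub>0\<close> be the number of triangles at \<open>P\<^sub>0\<close>.  Counting
  incidences, a zero continued fraction of length \<open>s\<close> has entry sum \<open>3 (s - 1) - v\<^sub>0\<close>, whereas a
  dual \<open>k\<close>-Wahl chain of length \<open>s\<close> has entry sum \<open>3 s - k - 1\<close>.  So every admissible zero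
  continued fraction of the chain has weight \<open>v\<^sub>0 + 1 - k \<ge> 2 - k\<close>, and it remains to find one with
  \<open>v\<^sub>0 = 1\<close>.  Those with \<open>v\<^sub>0 = 1\<close> come from \<open>[1, 1]\<close> by inner blow-ups alone.  Gluing a triangle
  to the side opposite to \<open>P\<^sub>0\<close> of the triangle \<open>P\<^sub>s P\<^sub>0 P\<^sub>1\<close> changes their entries exactly as the
  inductive steps for dual Wahl chains do, so an admissible one is carried along from the start
  of the induction.
\<close>

inductive inner_zero_cf :: "int list \<Rightarrow> bool" where
  base: "inner_zero_cf [1, 1]"
| blowup: "inner_zero_cf (xs @ [u, v] @ ys) \<Longrightarrow> inner_zero_cf (xs @ [u + 1, 1, v + 1] @ ys)"

lemma inner_zero_cf_imp_zero_cf: "inner_zero_cf es \<Longrightarrow> zero_cf es"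
  by (induction rule: inner_zero_cf.induct) (auto intro: zero_cf.intros simp del: append.simps)

lemma inner_zero_cf_rev: "inner_zero_cf es \<Longrightarrow> inner_zero_cf (rev es)"
proof (induction rule: inner_zero_cf.induct)
  case base
  show ?case by (simp add: inner_zero_cf.base)
next
  case (blowup xs u v ys)
  then show ?case using inner_zero_cf.blowup[of "rev ys" v u "rev xs"] by simp
qed

text \<open>
  Gluing a triangle commutes with an inner blow-up, which reduces the claim to \<open>[1, 1]\<close>, where it
  is itself an inner blow-up.
\<close>

lemma inner_zero_cf_glue_right:
  "inner_zero_cf es \<Longrightarrow> es = a # as \<Longrightarrow> inner_zero_cf ((a + 1) # as @ [2])"
proof (induction arbitrary: a as rule: inner_zero_cf.induct)
  case base
  then show ?case
    using inner_zero_cf.blowup[of "[]" 1 1 "[]"] inner_zero_cf.base by auto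
next
  case (blowup xs u v ys)
  show ?case
  proof (cases xs)
    case Nil
    with blowup.IH[of u "v # ys"] have "inner_zero_cf ([] @ [u + 1, v] @ (ys @ [2]))" by simp
    from inner_zero_cf.blowup[OF this] show ?thesis using Nil blowup.prems by auto
  next
    case (Cons x xs')
    with blowup.IH[of x "xs' @ [u, v] @ ys"]
    have "inner_zero_cf (((x + 1) # xs') @ [u, v] @ (ys @ [2]))" by simp
    from inner_zero_cf.blowup[OF this] show ?thesis using Cons blowup.prems by auto
  qed
qed

text \<open>Mirror image of \<open>inner_zero_cf_glue_right\<close> under reversal.\<close>

lemma inner_zero_cf_glue_left:
  "inner_zero_cf (as @ [a]) \<Longrightarrow> inner_zero_cf (2 # as @ [a + 1])"
  using inner_zero_cf_rev[of "as @ [a]"] inner_zero_cf_glue_right[of _ a "rev as"]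
    inner_zero_cf_rev[of "(a + 1) # rev as @ [2]"] by simp

text \<open>Equality holds at \<open>[1, 1]\<close>. An inner blow-up raises both sides by 3; an end
  blow-up raises the left side by only 2.\<close>

lemma zero_cf_sum_list_le: "zero_cf es \<Longrightarrow> sum_list es \<le> 3 * int (length es) - 4"
  by (induction rule: zero_cf.induct) auto

text \<open>Each inductive step adds 3 to the sum and 1 to the length.\<close>

lemma dual_wahl_sum_list:
  "dual_wahl k bs \<Longrightarrow> sum_list bs = 3 * int (length bs) - int k - 1"
  by (induction rule: dual_wahl.induct) (auto simp: sum_list_replicate)

text \<open>Trades index sets and decrements for an entrywise comparison and a difference of
  sums.\<close>

lemma admits_zero_cf_of_weight_iff:
  "admits_zero_cf_of_weight bs w \<longleftrightarrow>
     (\<exists>es. zero_cf es \<and> list_all2 (\<le>) es bs \<and> sum_list bs = sum_list es + int w + 1)"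
  (is "?L \<longleftrightarrow> ?R")
proof
  assume ?L
  then obtain I d where I: "I \<subseteq> {..<length bs}" and d: "\<forall>i\<in>I. 1 \<le> d i"
    and z: "zero_cf (subtract_at I d bs)" and w: "int w + 1 = (\<Sum>i\<in>I. d i)"
    by (auto simp: admits_zero_cf_of_weight_def)
  have le: "list_all2 (\<le>) (subtract_at I d bs) bs"
    using d by (fastforce simp: subtract_at_def list_all2_conv_all_nth)
  have "sum_list (subtract_at I d bs) = (\<Sum>i<length bs. bs ! i - (if i \<in> I then d i else 0))"
    unfolding subtract_at_def sum_list_sum_nth by (intro sum.cong) (auto simp: atLeast0LessThan)
  also have "\<dots> = sum_list bs - (\<Sum>i\<in>I. d i)"
    using I by (simp add: sum_subtractf sum_list_sum_nth atLeast0LessThan sum.If_cases Int_absorb1)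
  finally show ?R using z le w by (intro exI[of _ "subtract_at I d bs"]) simp
next
  assume ?R
  then obtain es where z: "zero_cf es" and le: "list_all2 (\<le>) es bs"
    and w: "sum_list bs = sum_list es + int w + 1" by blast
  define d where "d i = bs ! i - es ! i" for i
  define I where "I = {i. i < length bs \<and> es ! i < bs ! i}"
  have nth: "es ! i \<le> bs ! i" if "i < length bs" for i
    using le that by (auto simp: list_all2_conv_all_nth)
  have len: "length es = length bs" using le by (rule list_all2_lengthD)
  have "subtract_at I d bs = es"
    using len nth by (force simp: subtract_at_def I_def d_def intro!: nth_equalityI)
  moreover have "(\<Sum>i\<in>I. d i) = (\<Sum>i<length bs. d i)"
    using nth by (intro sum.mono_neutral_left) (force simp: I_def d_def)+
  moreover have "(\<Sum>i<length bs. d i) = int w + 1"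
    using w len by (simp add: d_def sum_subtractf sum_list_sum_nth atLeast0LessThan)
  \<comment> \<open>The decrements over \<open>I\<close> add up to \<open>w + 1\<close>, which is
    positive.\<close>
  moreover from calculation have "I \<noteq> {}" by auto
  ultimately show ?L
    using z unfolding admits_zero_cf_of_weight_def
    by (intro exI[of _ I] exI[of _ d]) (auto simp: I_def d_def)
qed

lemma dual_wahl_weight_ge:
  assumes "dual_wahl k bs" and "admits_zero_cf_of_weight bs w"
  shows "2 - int k \<le> int w"
proof -
  obtain es where "zero_cf es" "list_all2 (\<le>) es bs" "sum_list bs = sum_list es + int w + 1"
    using assms(2) by (auto simp: admits_zero_cf_of_weight_iff)
  then show ?thesis
    using dual_wahl_sum_list[OF assms(1)] zero_cf_sum_list_le[of es] list_all2_lengthD[of _ es bs]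
    by fastforce
qed

text \<open>The start \<open>[2]\<close> for \<open>k = 0\<close> is set apart, being too short to
  dominate a zero continued fraction.\<close>

lemma dual_wahl_inner_zero_cf:
  assumes "dual_wahl k bs" and "k \<le> 1"
  shows "bs = [2] \<or>
    (\<exists>es. inner_zero_cf es \<and> list_all2 (\<le>) es bs \<and> sum_list bs = sum_list es + 3 - int k)"
  using assms(1)
proof (induction rule: dual_wahl.induct)
  case base
  from assms(2) consider "k = 0" | "k = 1" by linarith
  then show ?case
    by cases (auto simp: numeral_2_eq_2 intro!: exI[of _ "[1, 1]"] inner_zero_cf.base)
next
  case (step_right b bs)
  from step_right.IH show ?case
  proof (elim disjE exE conjE)
    assume "b # bs = [2]"
    moreover have "k = 0" using dual_wahl_sum_list[OF step_right.hyps] calculation by simp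
    \<comment> \<open>The new chain is \<open>[3, 2]\<close>, with sum 3 more than that of
      \<open>[1, 1]\<close>.\<close>
    ultimately show ?case by (auto intro!: exI[of _ "[1, 1]"] inner_zero_cf.base)
  next
    fix es
    assume es: "inner_zero_cf es" "list_all2 (\<le>) es (b # bs)"
      "sum_list (b # bs) = sum_list es + 3 - int k"
    then obtain a as where "es = a # as" "a \<le> b" "list_all2 (\<le>) as bs"
      by (auto simp: list_all2_Cons2)
    \<comment> \<open>The same step applied to both chains keeps the entrywise order and the
      difference of sums.\<close>
    with es inner_zero_cf_glue_right[of es a as] show ?case
      by (intro disjI2 exI[of _ "(a + 1) # as @ [2]"]) (auto intro: list_all2_appendI)
  qed
next
  case (step_left bs b)
  from step_left.IH show ?case
  proof (elim disjE exE conjE)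
    assume "bs @ [b] = [2]"
    moreover have "k = 0" using dual_wahl_sum_list[OF step_left.hyps] calculation by simp
    ultimately show ?case by (auto intro!: exI[of _ "[1, 1]"] inner_zero_cf.base)
  next
    fix es
    assume es: "inner_zero_cf es" "list_all2 (\<le>) es (bs @ [b])"
      "sum_list (bs @ [b]) = sum_list es + 3 - int k"
    then obtain as a where "es = as @ [a]" "a \<le> b" "list_all2 (\<le>) as bs"
      by (auto simp: list_all2_append2 list_all2_Cons2)
    with es inner_zero_cf_glue_left[of as a] show ?case
      by (intro disjI2 exI[of _ "2 # as @ [a + 1]"]) (auto intro: list_all2_appendI)
  qed
qed

lemma alpha_dual_wahl:
  assumes "dual_wahl k bs" and "k \<le> 1" and "length bs \<ge> 2"
  shows "alpha bs = enat (2 - k)"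
proof -
  obtain es where "inner_zero_cf es" "list_all2 (\<le>) es bs" "sum_list bs = sum_list es + 3 - int k"
    using dual_wahl_inner_zero_cf[OF assms(1,2)] assms(3) by auto
  then have "admits_zero_cf_of_weight bs (2 - k)"
    using assms(2) inner_zero_cf_imp_zero_cf by (force simp: admits_zero_cf_of_weight_iff)
  moreover have "2 - k \<le> w" if "admits_zero_cf_of_weight bs w" for w
    using dual_wahl_weight_ge[OF assms(1) that] by linarith
  ultimately show ?thesis by (simp add: alpha_eq_iff)
qed

theorem theorem1p2:
  fixes bs :: "int list"
  assumes "length bs \<ge> 2"
    and "\<forall>b\<in>set bs. b \<ge> 2"
  shows "(dual_wahl 1 bs \<longrightarrow> alpha bs = 1) \<and> (dual_wahl 0 bs \<longrightarrow> alpha bs = 2)"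
  using alpha_dual_wahl[of 1 bs] alpha_dual_wahl[of 0 bs] assms(1)
  by (auto simp: one_enat_def numeral_eq_enat)

end
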